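(* Let $A$ be a non-empty set. Then the norm of $FBL[\ell_1(A)]$ has the strong Nakano property: for every upwards directed, norm bounded set $\mathcal F\subseteq FBL[\ell_1(A)]_+$ there is an upper bound $y_0\in FBL[\ell_1(A)]$ of $\mathcal F$ with $\|y_0\|=\sup\{\|x\|:x\in\mathcal F\}$.
   Context: For a real Banach space $E$ with dual $E^*$ and closed unit ball $B_E$, let $H[E]$ be the vector space of all positively homogeneous functions $f:E^*\to\mathbb R$ ($f(\lambda x^* )=\lambda f(x^* )$ for $\lambda>0$). For $f\in H[E]$ put $\|f\|_{FBL[E]}:=\sup\{\sum_{k=1}^n|f(x_k^* )| : n\in\mathbb N,\ x_1^*,\dots,x_n^*\in E^*,\ \sup_{x\in B_E}\sum_{k=1}^n|x_k^*(x)|\le 1\}$. $H_0[E]:=\{f\in H[E]:\|f\|_{FBL[E]}<\infty\}$ is a Banach lattice with this norm and pointwise order/operations. For $x\in E$ let $\delta_x(x^* )=x^*(x)$. $FBL[E]$ is the closed sublattice of $H_0[E]$ generated by $\{\delta_x:x\in E\}$. Here $E=\ell_1(A)$, whose dual is identified with $\ell_\infty(A)$. For a Banach lattice $X$, $X_+=\{x\in X:x\ge0\}$. *)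

theory Defs
  imports "HOL-Analysis.Analysis"
begin

text \<open>The index set A is modelled by the (automatically non-empty) type 'a.
  E = l1(A) consists of absolutely summable functions 'a => real;
  its dual is identified with l_inf(A), the bounded functions 'a => real.\<close>

definition ell1 :: "('a \<Rightarrow> real) set" where
  "ell1 = {x. (\<lambda>a. \<bar>x a\<bar>) summable_on UNIV}"

definition ell1_norm :: "('a \<Rightarrow> real) \<Rightarrow> real" where
  "ell1_norm x = (\<Sum>\<^sub>\<infinity>a. \<bar>x a\<bar>)"

definition ell1_ball :: "('a \<Rightarrow> real) set" where
  "ell1_ball = {x \<in> ell1. ell1_norm x \<le> 1}"

definition ellinf :: "('a \<Rightarrow> real) set" where
  "ellinf = {xs. bounded (range xs)}"

definition pair :: "('a \<Rightarrow> real) \<Rightarrow> ('a \<Rightarrow> real) \<Rightarrow> real" where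
  "pair xs x = (\<Sum>\<^sub>\<infinity>a. xs a * x a)"

text \<open>Positively homogeneous functions on E* = l_inf(A); we take them extensional
  (zero outside l_inf(A)) so that functions on E* are represented uniquely.\<close>
definition Hom :: "(('a \<Rightarrow> real) \<Rightarrow> real) set" where
  "Hom = {f. (\<forall>xs\<in>ellinf. \<forall>t>0. f (\<lambda>a. t * xs a) = t * f xs) \<and> (\<forall>xs. xs \<notin> ellinf \<longrightarrow> f xs = 0)}"

definition fbl_sums :: "(('a \<Rightarrow> real) \<Rightarrow> real) \<Rightarrow> real set" where
  "fbl_sums f = {(\<Sum>k<(n::nat). \<bar>f (xs k)\<bar>) | n xs.
      (\<forall>k<n. xs k \<in> ellinf) \<and> (\<forall>x\<in>ell1_ball. (\<Sum>k<n. \<bar>pair (xs k) x\<bar>) \<le> 1)}"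

definition fbl_norm :: "(('a \<Rightarrow> real) \<Rightarrow> real) \<Rightarrow> real" where
  "fbl_norm f = Sup (fbl_sums f)"

definition H0 :: "(('a \<Rightarrow> real) \<Rightarrow> real) set" where
  "H0 = {f \<in> Hom. bdd_above (fbl_sums f)}"

definition delta :: "('a \<Rightarrow> real) \<Rightarrow> ('a \<Rightarrow> real) \<Rightarrow> real" where
  "delta x = (\<lambda>xs. if xs \<in> ellinf then pair xs x else 0)"

definition FBL :: "(('a \<Rightarrow> real) \<Rightarrow> real) set" where
  "FBL = \<Inter>{S. S \<subseteq> H0 \<and> delta ` ell1 \<subseteq> S
      \<and> (\<forall>f\<in>S. \<forall>g\<in>S. (\<lambda>xs. f xs + g xs) \<in> S)
      \<and> (\<forall>f\<in>S. \<forall>c::real. (\<lambda>xs. c * f xs) \<in> S)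
      \<and> (\<forall>f\<in>S. \<forall>g\<in>S. (\<lambda>xs. max (f xs) (g xs)) \<in> S)
      \<and> (\<forall>f\<in>S. \<forall>g\<in>S. (\<lambda>xs. min (f xs) (g xs)) \<in> S)
      \<and> (\<forall>g f. (\<forall>n. g n \<in> S) \<and> f \<in> H0 \<and>
             (\<lambda>n. fbl_norm (\<lambda>xs. g n xs - f xs)) \<longlonglongrightarrow> 0 \<longrightarrow> f \<in> S)}"

definition fle :: "(('a \<Rightarrow> real) \<Rightarrow> real) \<Rightarrow> (('a \<Rightarrow> real) \<Rightarrow> real) \<Rightarrow> bool" where
  "fle f g = (\<forall>xs\<in>ellinf. f xs \<le> g xs)"

end

theory Submission
  imports Defs
begin

text \<open>
  The upper bound has the form \<open>y\<^sub>0(x) = \<Sum>\<^sub>a c\<^sub>a \<bar>x(a)\<bar>\<close> with \<open>c \<ge> 0\<close> and \<open>\<Sum>\<^sub>a c\<^sub>a \<le> M\<close>, where \<open>M\<close>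
  is the supremum of the norms; such a \<open>y\<^sub>0\<close> is the norm limit of its finite partial sums, which
  are combinations of the \<open>\<bar>delta (unit_vec a)\<bar>\<close>, and its norm is at most \<open>M\<close>. To find \<open>c\<close>, first require
  \<open>f(x) \<le> \<Sum>\<^sub>a c\<^sub>a \<bar>x(a)\<bar>\<close> only for \<open>f \<in> F\<close> and finitely supported \<open>x\<close>. These are closed conditions
  on a set of weights that is compact for pointwise convergence. Finitely many of them can be
  met by a minimax argument in the spirit of Pietsch's factorization theorem: as \<open>F\<close> is directed,
  some \<open>h \<in> F\<close> dominates all the functions involved, and the dual condition is the bound of
  \<open>\<Sum>\<^sub>i h(l\<^sub>i x\<^sub>i)\<close> by the norm of \<open>h\<close>. The inequality extends to all bounded \<open>x\<close> because
  elements of \<open>FBL\<close> are weak* continuous on bounded sets.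
\<close>

section \<open>Weights of bounded total mass\<close>

text \<open>The mass is bounded through finite partial sums: each condition then involves finitely
  many coordinates and survives pointwise limits.\<close>

definition weights :: "real \<Rightarrow> ('a \<Rightarrow> real) set" where
  "weights M = {c. (\<forall>a. 0 \<le> c a) \<and> (\<forall>B. finite B \<longrightarrow> sum c B \<le> M)}"

text \<open>Tychonoff: functions carry the product topology, and \<open>weights M\<close> is a
  closed subset of a power of the interval \<open>{0..M}\<close>.\<close>

lemma compact_weights: "compact (weights M :: ('a \<Rightarrow> real) set)"
proof -
  have "compactin (product_topology (\<lambda>_. euclidean) UNIV) (PiE UNIV (\<lambda>_::'a. {0..M}))"
    by (subst compactin_PiE) auto
  then have "compact (PiE UNIV (\<lambda>_::'a. {0..M}))"
    by (simp add: euclidean_product_topology)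
  moreover have "closed (weights M :: ('a \<Rightarrow> real) set)"
    unfolding weights_def
    by (intro closed_Collect_conj closed_Collect_all closed_Collect_imp closed_Collect_le
        continuous_on_sum continuous_on_const) auto
  ultimately have "compact (PiE UNIV (\<lambda>_::'a. {0..M}) \<inter> weights M)"
    by (rule compact_Int_closed)
  moreover have "PiE UNIV (\<lambda>_::'a. {0..M}) \<inter> weights M = weights M"
  proof -
    have "c a \<le> M" if "c \<in> weights M" for c and a :: 'a
      using that unfolding weights_def by (auto dest!: spec[of _ "{a}"])
    then show ?thesis by (auto simp: PiE_def weights_def)
  qed
  ultimately show ?thesis by simp
qed

lemma weights_convex:
  assumes "c \<in> weights M" "d \<in> weights M" "0 \<le> t" "t \<le> 1"
  shows "(\<lambda>a. (1 - t) * c a + t * d a) \<in> weights M"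
proof -
  have "(\<Sum>a\<in>B. (1 - t) * c a + t * d a) \<le> M" if "finite B" for B
  proof -
    have "(\<Sum>a\<in>B. (1 - t) * c a + t * d a) = (1 - t) * sum c B + t * sum d B"
      by (simp add: sum.distrib sum_distrib_left)
    also have "\<dots> \<le> (1 - t) * M + t * M"
      using assms that by (intro add_mono mult_left_mono) (auto simp: weights_def)
    finally show ?thesis by (simp add: algebra_simps)
  qed
  then show ?thesis using assms by (auto simp: weights_def)
qed

lemma weights_point:
  assumes "0 \<le> M"
  shows "(\<lambda>b. if b = a then M else 0) \<in> weights M"
  using assms by (auto simp: weights_def)

text \<open>A finite minimax argument: the weight \<open>c0\<close> minimising the squared violation of the
  constraints satisfies a first order condition in the direction of each extreme point \<open>M e\<^sub>b\<close>,
  and the violations at \<open>c0\<close> are then multipliers contradicting the hypothesis unless they vanish.\<close>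
lemma finite_domination:
  fixes w :: "'i \<Rightarrow> 'a \<Rightarrow> real" and r :: "'i \<Rightarrow> real"
  assumes I: "finite I" and M: "0 \<le> M"
    and supp: "\<And>i. i \<in> I \<Longrightarrow> finite {a. w i a \<noteq> 0}"
    and w: "\<And>i a. i \<in> I \<Longrightarrow> 0 \<le> w i a"
    and dual: "\<And>l T. \<lbrakk>\<And>i. i \<in> I \<Longrightarrow> 0 \<le> l i; 0 < T; \<And>a. (\<Sum>i\<in>I. l i * w i a) \<le> T\<rbrakk>
      \<Longrightarrow> (\<Sum>i\<in>I. l i * r i) \<le> M * T"
  shows "\<exists>c\<in>weights M. \<forall>i\<in>I. r i \<le> (\<Sum>a | w i a \<noteq> 0. c a * w i a)"
proof -
  define L where "L c i = (\<Sum>a | w i a \<noteq> 0. c a * w i a)" for c i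
  define \<Phi> where "\<Phi> c = (\<Sum>i\<in>I. (max 0 (r i - L c i))\<^sup>2)" for c
  have "continuous_on UNIV \<Phi>"
    unfolding \<Phi>_def L_def
    by (intro continuous_on_sum continuous_on_power continuous_on_max continuous_on_diff
        continuous_on_mult continuous_on_const) auto
  then have "continuous_on (weights M) \<Phi>"
    by (rule continuous_on_subset) simp
  moreover have "weights M \<noteq> ({} :: ('a \<Rightarrow> real) set)"
    using weights_point[OF M, of "undefined :: 'a"] by (metis empty_iff)
  ultimately have "\<exists>c0\<in>weights M. \<forall>c\<in>weights M. \<Phi> c0 \<le> \<Phi> c"
    by (intro continuous_attains_inf compact_weights)
  then obtain c0 where c0: "c0 \<in> weights M" "\<And>c. c \<in> weights M \<Longrightarrow> \<Phi> c0 \<le> \<Phi> c"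
    by blast
  define l where "l i = max 0 (r i - L c0 i)" for i
  define S where "S = (\<Sum>i\<in>I. l i * r i)"
  define \<delta> where "\<delta> = (\<Sum>i\<in>I. (l i)\<^sup>2)"
  \<comment> \<open>Let \<open>d i\<close> be the change of \<open>L\<close> at \<open>i\<close>
    along the direction from \<open>c0\<close> to the extreme point at \<open>b\<close>. Minimality
    of \<open>c0\<close> makes the sum of \<open>l i * d i\<close> nonpositive. Its part coming from
    \<open>c0\<close> is \<open>S - \<delta>\<close>, because \<open>l i * (r i - L c0 i)\<close> is
    the square of \<open>l i\<close>.\<close>
  have first_order: "M * (\<Sum>i\<in>I. l i * w i b) \<le> S - \<delta>" for b
  proof -
    define d where "d i = M * w i b - L c0 i" for i
    have small: "2 * (\<Sum>i\<in>I. l i * d i) \<le> t * (\<Sum>i\<in>I. (d i)\<^sup>2)" if t: "0 < t" "t \<le> 1" for t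
    proof -
      let ?e = "\<lambda>a. if a = b then M else 0"
      let ?c = "\<lambda>a. (1 - t) * c0 a + t * ?e a"
      have "L ?c i = L c0 i + t * d i" if i: "i \<in> I" for i
      proof -
        have "(\<Sum>a | w i a \<noteq> 0. ?e a * w i a) = (\<Sum>a | w i a \<noteq> 0. if a = b then M * w i b else 0)"
          by (intro sum.cong) auto
        also have "\<dots> = M * w i b"
          using supp[OF i] by (subst sum.delta) auto
        finally have e: "(\<Sum>a | w i a \<noteq> 0. ?e a * w i a) = M * w i b" .
        have "L ?c i = (1 - t) * L c0 i + t * (\<Sum>a | w i a \<noteq> 0. ?e a * w i a)"
          unfolding L_def by (simp only: distrib_right sum.distrib sum_distrib_left mult.assoc)
        then show ?thesis unfolding e d_def by (simp only: left_diff_distrib right_diff_distrib)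
      qed
      \<comment> \<open>This bounds \<open>\<Phi>\<close> on the segment by a quadratic in
        \<open>t\<close> that agrees with \<open>\<Phi> c0\<close> at \<open>t = 0\<close>.\<close>
      moreover have "(max 0 (z - s))\<^sup>2 \<le> (max 0 z - s)\<^sup>2" for z s :: real
      proof -
        have "\<bar>max 0 (z - s)\<bar> \<le> \<bar>max 0 z - s\<bar>" by linarith
        then show ?thesis by (rule abs_le_square_iff[THEN iffD1])
      qed
      from this[of "r i - L c0 i" "t * d i" for i]
      have "(max 0 (r i - (L c0 i + t * d i)))\<^sup>2 \<le> (l i - t * d i)\<^sup>2" for i
        by (simp add: l_def algebra_simps)
      ultimately have "\<Phi> ?c \<le> (\<Sum>i\<in>I. (l i - t * d i)\<^sup>2)"
        unfolding \<Phi>_def by (intro sum_mono) simp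
      also have "\<dots> = \<Phi> c0 - 2 * t * (\<Sum>i\<in>I. l i * d i) + t\<^sup>2 * (\<Sum>i\<in>I. (d i)\<^sup>2)"
        unfolding \<Phi>_def l_def[symmetric]
        by (simp add: sum_distrib_left power2_diff power_mult_distrib sum.distrib sum_subtractf
            algebra_simps)
      finally have "\<Phi> ?c \<le> \<dots>" .
      moreover have "\<Phi> c0 \<le> \<Phi> ?c"
        using t M by (intro c0 weights_convex weights_point) auto
      ultimately have "t * (2 * (\<Sum>i\<in>I. l i * d i)) \<le> t * (t * (\<Sum>i\<in>I. (d i)\<^sup>2))"
        by (simp add: power2_eq_square algebra_simps)
      then show ?thesis using t by simp
    qed
    have "2 * (\<Sum>i\<in>I. l i * d i) \<le> 0"
    proof (rule tendsto_lowerbound)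
      show "((\<lambda>t. t * (\<Sum>i\<in>I. (d i)\<^sup>2)) \<longlongrightarrow> 0) (at_right 0)"
        by (auto intro!: tendsto_eq_intros)
      show "\<forall>\<^sub>F t in at_right 0. 2 * (\<Sum>i\<in>I. l i * d i) \<le> t * (\<Sum>i\<in>I. (d i)\<^sup>2)"
        by (rule eventually_at_rightI[of 0 1]) (auto intro: small)
    qed simp
    moreover have "l i * L c0 i = l i * r i - (l i)\<^sup>2" for i
      by (auto simp: l_def max_def power2_eq_square algebra_simps)
    then have "S - \<delta> = (\<Sum>i\<in>I. l i * L c0 i)"
      unfolding S_def \<delta>_def by (simp flip: sum_subtractf)
    then have "(\<Sum>i\<in>I. l i * d i) = M * (\<Sum>i\<in>I. l i * w i b) - (S - \<delta>)"
      unfolding d_def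
      by (simp add: right_diff_distrib sum_subtractf sum_distrib_left mult.left_commute)
    ultimately show ?thesis by simp
  qed
  have l: "0 \<le> l i" for i by (simp add: l_def)
  have "0 \<le> M * (\<Sum>i\<in>I. l i * w i undefined)"
    using M l w by (intro mult_nonneg_nonneg sum_nonneg) auto
  then have S: "\<delta> \<le> S" using first_order[of undefined] by linarith
  have "\<delta> \<le> 0"
  \<comment> \<open>The choice of \<open>T\<close> for \<open>dual\<close> divides by
    \<open>M\<close>. For \<open>M = 0\<close> any positive \<open>T\<close> above all the sums of
    \<open>l i * w i a\<close> gives \<open>S \<le> 0\<close>, hence
    \<open>\<delta> \<le> 0\<close>.\<close>
  proof (cases "M = 0")
    case True
    define T where "T = 1 + (\<Sum>i\<in>I. \<Sum>a | w i a \<noteq> 0. \<bar>l i * w i a\<bar>)"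
    have "(\<Sum>i\<in>I. l i * w i a) \<le> T" for a
    proof -
      have "l i * w i a \<le> (\<Sum>a | w i a \<noteq> 0. \<bar>l i * w i a\<bar>)" if "i \<in> I" for i
      proof (cases "w i a = 0")
        case False
        then have "\<bar>l i * w i a\<bar> \<le> (\<Sum>a | w i a \<noteq> 0. \<bar>l i * w i a\<bar>)"
          using supp[OF that] by (intro member_le_sum) auto
        then show ?thesis by linarith
      qed (simp add: sum_nonneg)
      then have "(\<Sum>i\<in>I. l i * w i a) \<le> (\<Sum>i\<in>I. \<Sum>a | w i a \<noteq> 0. \<bar>l i * w i a\<bar>)"
        by (rule sum_mono)
      then show ?thesis by (simp add: T_def)
    qed
    moreover have "0 < T" unfolding T_def by (intro add_pos_nonneg sum_nonneg) auto
    ultimately have "S \<le> M * T" unfolding S_def using l by (intro dual)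
    then show ?thesis using True first_order[of undefined] by simp
  next
    case False
    then have "M > 0" using M by simp
    show ?thesis
    proof (rule ccontr)
      assume "\<not> \<delta> \<le> 0"
      \<comment> \<open>The bound \<open>(S - \<delta>) / M\<close> from \<open>first_order\<close>
        may be 0. Giving away half of \<open>\<delta>\<close> makes \<open>T\<close> positive and
        still keeps \<open>M * T < S\<close>, against \<open>dual\<close>.\<close>
      define T where "T = (S - \<delta> / 2) / M"
      have "(\<Sum>i\<in>I. l i * w i a) \<le> T" for a
        using first_order[of a] \<open>M > 0\<close> \<open>\<not> \<delta> \<le> 0\<close>
        by (simp add: T_def field_simps)
      moreover have "0 < T" using \<open>\<not> \<delta> \<le> 0\<close> \<open>M > 0\<close> S by (simp add: T_def)
      ultimately have "S \<le> M * T" unfolding S_def using l by (intro dual)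
      then show False using \<open>M > 0\<close> \<open>\<not> \<delta> \<le> 0\<close>
        by (simp add: T_def)
    qed
  qed
  then have "\<forall>i\<in>I. (l i)\<^sup>2 = 0"
    using I unfolding \<delta>_def
    by (metis (no_types, lifting) antisym sum_nonneg sum_nonneg_eq_0_iff zero_le_power2)
  then have "\<forall>i\<in>I. r i \<le> L c0 i" by (auto simp: l_def max_def split: if_splits)
  then show ?thesis using c0(1) unfolding L_def by blast
qed

section \<open>The norm and the space \<open>H0\<close>\<close>

lemma ellinfI: "(\<And>a. \<bar>x a\<bar> \<le> T) \<Longrightarrow> x \<in> ellinf"
  unfolding ellinf_def bounded_iff by auto

lemma ellinfE:
  assumes "x \<in> ellinf"
  obtains T where "0 < T" "\<And>a. \<bar>x a\<bar> \<le> T"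
proof -
  from assms obtain T where "\<And>a. \<bar>x a\<bar> \<le> T"
    unfolding ellinf_def bounded_iff by auto
  then have "\<bar>x a\<bar> \<le> max T 1" for a by (simp add: le_max_iff_disj)
  then show thesis using that[of "max T 1"] by auto
qed

lemma ellinf_scale: "x \<in> ellinf \<Longrightarrow> (\<lambda>a. t * x a) \<in> ellinf"
proof -
  assume "x \<in> ellinf"
  then obtain T where "\<And>a. \<bar>x a\<bar> \<le> T" using ellinfE by blast
  then show ?thesis by (intro ellinfI[where T = "\<bar>t\<bar> * T"]) (simp add: abs_mult mult_left_mono)
qed

lemma ellinf_scale_iff: "0 < t \<Longrightarrow> (\<lambda>a. t * x a) \<in> ellinf \<longleftrightarrow> x \<in> ellinf"
  using ellinf_scale[of x t] ellinf_scale[of "\<lambda>a. t * x a" "1 / t"] by auto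

lemma summable_weighted:
  fixes d x :: "'a \<Rightarrow> real"
  assumes d: "(\<lambda>a. \<bar>d a\<bar>) summable_on UNIV" and x: "\<And>a. \<bar>x a\<bar> \<le> T"
  shows "(\<lambda>a. \<bar>d a * x a\<bar>) summable_on UNIV" "(\<lambda>a. d a * x a) summable_on UNIV"
    "(\<Sum>\<^sub>\<infinity>a. \<bar>d a * x a\<bar>) \<le> (\<Sum>\<^sub>\<infinity>a. \<bar>d a\<bar>) * T"
proof -
  have le: "\<bar>d a * x a\<bar> \<le> \<bar>d a\<bar> * T" for a
    using x by (simp add: abs_mult mult_left_mono)
  have s: "(\<lambda>a. \<bar>d a\<bar> * T) summable_on UNIV"
    using d by (rule summable_on_cmult_left)
  show *: "(\<lambda>a. \<bar>d a * x a\<bar>) summable_on UNIV"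
    by (rule summable_on_comparison_test[OF s]) (use le in auto)
  then show "(\<lambda>a. d a * x a) summable_on UNIV"
    using abs_summable_summable[of "\<lambda>a. d a * x a" UNIV] by simp
  have "(\<Sum>\<^sub>\<infinity>a. \<bar>d a * x a\<bar>) \<le> (\<Sum>\<^sub>\<infinity>a. \<bar>d a\<bar> * T)"
    using * s le by (intro infsum_mono) auto
  also have "\<dots> = (\<Sum>\<^sub>\<infinity>a. \<bar>d a\<bar>) * T" by (rule infsum_cmult_left')
  finally show "(\<Sum>\<^sub>\<infinity>a. \<bar>d a * x a\<bar>) \<le> (\<Sum>\<^sub>\<infinity>a. \<bar>d a\<bar>) * T" .
qed

lemma summable_pair:
  assumes "xs \<in> ellinf" "x \<in> ell1"
  shows "(\<lambda>a. \<bar>xs a * x a\<bar>) summable_on UNIV" "(\<lambda>a. xs a * x a) summable_on UNIV"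
    "\<bar>pair xs x\<bar> \<le> (\<Sum>\<^sub>\<infinity>a. \<bar>xs a * x a\<bar>)"
proof -
  obtain T where "\<And>a. \<bar>xs a\<bar> \<le> T" using assms(1) ellinfE by blast
  from summable_weighted[of x xs, OF _ this] assms(2)
  show *: "(\<lambda>a. \<bar>xs a * x a\<bar>) summable_on UNIV" "(\<lambda>a. xs a * x a) summable_on UNIV"
    by (auto simp: ell1_def mult.commute)
  from *(1) show "\<bar>pair xs x\<bar> \<le> (\<Sum>\<^sub>\<infinity>a. \<bar>xs a * x a\<bar>)"
    using norm_infsum_bound[of "\<lambda>a. xs a * x a" UNIV] by (simp add: pair_def)
qed

definition unit_vec :: "'a \<Rightarrow> 'a \<Rightarrow> real" where
  "unit_vec a = (\<lambda>b. if b = a then 1 else 0)"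

lemma infsum_unit_vec: "(\<Sum>\<^sub>\<infinity>b. g b * unit_vec a b) = (g a :: real)"
proof -
  have "(\<Sum>\<^sub>\<infinity>b. g b * unit_vec a b) = (\<Sum>\<^sub>\<infinity>b\<in>{a}. g b)"
    by (rule infsum_cong_neutral) (auto simp: unit_vec_def)
  then show ?thesis by simp
qed

lemma pair_unit_vec: "pair xs (unit_vec a) = xs a"
  unfolding pair_def by (rule infsum_unit_vec)

lemma unit_vec_ball: "unit_vec a \<in> ell1_ball"
proof -
  have eq: "\<bar>unit_vec a b\<bar> = 1 * unit_vec a b" for b by (simp add: unit_vec_def)
  have "(\<lambda>b. \<bar>unit_vec a b\<bar>) summable_on UNIV \<longleftrightarrow> (\<lambda>b. 1 :: real) summable_on {a}"
    by (rule summable_on_cong_neutral) (auto simp: unit_vec_def)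
  moreover have "ell1_norm (unit_vec a) = 1"
    unfolding ell1_norm_def eq infsum_unit_vec ..
  ultimately show ?thesis unfolding ell1_ball_def ell1_def by simp
qed

lemma
  fixes f :: "'i \<Rightarrow> 'a \<Rightarrow> 'b :: {topological_comm_monoid_add, t2_space}"
  assumes "finite I" "\<And>i. i \<in> I \<Longrightarrow> f i summable_on A"
  shows summable_on_sum: "(\<lambda>a. \<Sum>i\<in>I. f i a) summable_on A"
    and infsum_sum: "(\<Sum>\<^sub>\<infinity>a\<in>A. \<Sum>i\<in>I. f i a) = (\<Sum>i\<in>I. \<Sum>\<^sub>\<infinity>a\<in>A. f i a)"
proof -
  have "((\<lambda>a. \<Sum>i\<in>I. f i a) has_sum (\<Sum>i\<in>I. \<Sum>\<^sub>\<infinity>a\<in>A. f i a)) A"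
    using assms by induction (auto intro!: has_sum_add)
  then show "(\<lambda>a. \<Sum>i\<in>I. f i a) summable_on A"
    "(\<Sum>\<^sub>\<infinity>a\<in>A. \<Sum>i\<in>I. f i a) = (\<Sum>i\<in>I. \<Sum>\<^sub>\<infinity>a\<in>A. f i a)"
    by (auto simp: has_sum_iff)
qed

text \<open>Exchanging the finite sum with the series reduces the estimate to single coordinates.
  With \<open>T = 1\<close> it carries a constraint tested on unit vectors over to the whole unit
  ball.\<close>

lemma pair_sum_le:
  assumes I: "finite I" and xs: "\<And>k. k \<in> I \<Longrightarrow> xs k \<in> ellinf" and x: "x \<in> ell1"
    and T: "\<And>a. (\<Sum>k\<in>I. \<bar>xs k a\<bar>) \<le> T"
  shows "(\<Sum>k\<in>I. \<bar>pair (xs k) x\<bar>) \<le> T * ell1_norm x"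
proof -
  have "(\<Sum>k\<in>I. \<bar>pair (xs k) x\<bar>) \<le> (\<Sum>k\<in>I. \<Sum>\<^sub>\<infinity>a. \<bar>xs k a * x a\<bar>)"
    using summable_pair(3) xs x by (intro sum_mono) blast
  also have "\<dots> = (\<Sum>\<^sub>\<infinity>a. \<Sum>k\<in>I. \<bar>xs k a * x a\<bar>)"
    using summable_pair(1)[OF xs x] by (intro infsum_sum[symmetric] I)
  also have "\<dots> \<le> (\<Sum>\<^sub>\<infinity>a. T * \<bar>x a\<bar>)"
  proof (rule infsum_mono)
    show "(\<lambda>a. \<Sum>k\<in>I. \<bar>xs k a * x a\<bar>) summable_on UNIV"
      using summable_pair(1)[OF xs x] by (intro summable_on_sum I)
    show "(\<lambda>a. T * \<bar>x a\<bar>) summable_on UNIV"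
      using x unfolding ell1_def by (intro summable_on_cmult_right) simp
    show "(\<Sum>k\<in>I. \<bar>xs k a * x a\<bar>) \<le> T * \<bar>x a\<bar>" for a
      using T by (simp add: abs_mult flip: sum_distrib_right) (simp add: mult_right_mono)
  qed
  also have "\<dots> = T * ell1_norm x" unfolding ell1_norm_def by (rule infsum_cmult_right')
  finally show ?thesis .
qed

text \<open>The extreme points of the unit ball of \<open>\<ell>\<^sub>1\<close> are \<open>\<plusminus>e\<^sub>a\<close>, so the constraint in the
  definition of the norm only has to be tested on unit vectors.\<close>
lemma fbl_sums_eq:
  "fbl_sums f = {(\<Sum>k<(n::nat). \<bar>f (xs k)\<bar>) | n xs. \<forall>a. (\<Sum>k<n. \<bar>xs k a\<bar>) \<le> 1}"
proof -
  have "(\<forall>k<n. xs k \<in> ellinf) \<and> (\<forall>x\<in>ell1_ball. (\<Sum>k<n. \<bar>pair (xs k) x\<bar>) \<le> 1)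
      \<longleftrightarrow> (\<forall>a. (\<Sum>k<n. \<bar>xs k a\<bar>) \<le> 1)" (is "?L \<longleftrightarrow> ?R") for n :: nat and xs :: "nat \<Rightarrow> 'a \<Rightarrow> real"
  proof
    assume ?L
    then show ?R using unit_vec_ball pair_unit_vec by (metis (no_types, lifting) sum.cong)
  next
    assume R: ?R
    have "\<bar>xs k a\<bar> \<le> 1" if "k < n" for k a
      using R member_le_sum[of k "{..<n}" "\<lambda>k. \<bar>xs k a\<bar>"] that by (auto intro: order_trans)
    then have "\<forall>k<n. xs k \<in> ellinf" by (auto intro: ellinfI)
    moreover have "(\<Sum>k<n. \<bar>pair (xs k) x\<bar>) \<le> 1" if "x \<in> ell1_ball" for x
      using pair_sum_le[of "{..<n}" xs x 1] calculation that R by (auto simp: ell1_ball_def)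
    ultimately show ?L by blast
  qed
  then show ?thesis unfolding fbl_sums_def by simp
qed

text \<open>The empty family contributes 0, so the supremum in \<open>fbl_norm\<close> is never over
  the empty set.\<close>

lemma fbl_sums_0: "0 \<in> fbl_sums f"
  unfolding fbl_sums_eq by (force intro: exI[of _ "0::nat"])

text \<open>Enumeration allows any finite index set; later the indices are pairs of a function and a
  point.\<close>

lemma fbl_sums_finite:
  assumes "finite I" "\<And>a. (\<Sum>i\<in>I. \<bar>x i a\<bar>) \<le> 1"
  shows "(\<Sum>i\<in>I. \<bar>f (x i)\<bar>) \<in> fbl_sums f"
proof -
  obtain h where h: "bij_betw h {..<card I} I"
    using ex_bij_betw_nat_finite[OF assms(1)] atLeast0LessThan by auto
  have "(\<Sum>i\<in>I. \<bar>f (x i)\<bar>) = (\<Sum>k<card I. \<bar>f ((x \<circ> h) k)\<bar>)"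
    using sum.reindex_bij_betw[OF h] by (metis (no_types, lifting) comp_apply sum.cong)
  moreover have "(\<Sum>k<card I. \<bar>(x \<circ> h) k a\<bar>) \<le> 1" for a
    using sum.reindex_bij_betw[OF h, of "\<lambda>i. \<bar>x i a\<bar>"] assms(2)[of a] by simp
  ultimately show ?thesis unfolding fbl_sums_eq by blast
qed

text \<open>Homogeneity holds at every \<open>x\<close>: outside \<open>ellinf\<close> both sides
  vanish, since positive scaling does not change membership in \<open>ellinf\<close>.\<close>

lemma H0D:
  assumes "f \<in> H0"
  shows "x \<notin> ellinf \<Longrightarrow> f x = 0" "0 < t \<Longrightarrow> f (\<lambda>a. t * x a) = t * f x" "bdd_above (fbl_sums f)"
  using assms ellinf_scale_iff[of t x] unfolding H0_def Hom_def by (cases "x \<in> ellinf"; auto)+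

lemma H0_zero:
  assumes "f \<in> H0"
  shows "f (\<lambda>a. 0) = 0"
  using H0D(2)[OF assms, of 2 "\<lambda>a. 0"] by simp

lemma fbl_norm_nonneg: "f \<in> H0 \<Longrightarrow> 0 \<le> fbl_norm f"
  unfolding fbl_norm_def using H0D(3) fbl_sums_0 by (intro cSup_upper)

text \<open>Dividing by \<open>T\<close> makes the family admissible, and homogeneity brings the
  factor back out.\<close>

lemma fbl_norm_bound:
  assumes f: "f \<in> H0" and "finite I" and T: "0 < T" "\<And>a. (\<Sum>i\<in>I. \<bar>x i a\<bar>) \<le> T"
  shows "(\<Sum>i\<in>I. \<bar>f (x i)\<bar>) \<le> fbl_norm f * T"
proof -
  let ?y = "\<lambda>i a. (1 / T) * x i a"
  have "(\<Sum>i\<in>I. \<bar>?y i a\<bar>) \<le> 1" for a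
  proof -
    have "(\<Sum>i\<in>I. \<bar>?y i a\<bar>) = (\<Sum>i\<in>I. \<bar>x i a\<bar>) / T"
      using T(1) by (simp add: abs_mult sum_divide_distrib)
    then show ?thesis using T by simp
  qed
  then have "(\<Sum>i\<in>I. \<bar>f (?y i)\<bar>) \<in> fbl_sums f"
    by (intro fbl_sums_finite assms)
  then have "(\<Sum>i\<in>I. \<bar>f (?y i)\<bar>) \<le> fbl_norm f"
    unfolding fbl_norm_def by (intro cSup_upper H0D(3)[OF f])
  moreover have "f (?y i) = (1 / T) * f (x i)" for i
    using T(1) by (intro H0D(2)[OF f]) simp
  then have "(\<Sum>i\<in>I. \<bar>f (?y i)\<bar>) = (\<Sum>i\<in>I. \<bar>f (x i)\<bar>) / T"
    using T(1) by (simp add: abs_mult sum_divide_distrib)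
  ultimately show ?thesis using T(1) by (simp only: pos_divide_le_eq)
qed

lemma fbl_norm_bound_single:
  assumes "f \<in> H0" "0 < T" "\<And>a. \<bar>x a\<bar> \<le> T"
  shows "\<bar>f x\<bar> \<le> fbl_norm f * T"
  using fbl_norm_bound[of f "{()}" T "\<lambda>_. x"] assms by simp

text \<open>One estimate over admissible families, tested on coordinates as in
  \<open>fbl_sums_eq\<close>, gives both membership and the norm bound.\<close>

lemma H0I:
  assumes "\<And>x t. x \<in> ellinf \<Longrightarrow> 0 < t \<Longrightarrow> f (\<lambda>a. t * x a) = t * f x"
    and "\<And>x. x \<notin> ellinf \<Longrightarrow> f x = 0"
    and "\<And>n xs. (\<And>a. (\<Sum>k<(n::nat). \<bar>xs k a\<bar>) \<le> 1) \<Longrightarrow> (\<Sum>k<n. \<bar>f (xs k)\<bar>) \<le> C"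
  shows "f \<in> H0" "fbl_norm f \<le> C"
proof -
  have "\<forall>s\<in>fbl_sums f. s \<le> C" unfolding fbl_sums_eq using assms(3) by blast
  then show "f \<in> H0" "fbl_norm f \<le> C"
    using assms(1,2) fbl_sums_0[of f] unfolding H0_def Hom_def fbl_norm_def
    by (auto intro!: bdd_aboveI[of _ C] cSup_least)
qed

text \<open>The norm sums of \<open>h\<close> are controlled by those of \<open>f\<close> and
  \<open>g\<close>.\<close>

lemma H0_dominated:
  assumes f: "f \<in> H0" and g: "g \<in> H0"
    and "\<And>x t. x \<in> ellinf \<Longrightarrow> 0 < t \<Longrightarrow> h (\<lambda>a. t * x a) = t * h x"
    and le: "\<And>x. \<bar>h x\<bar> \<le> C * \<bar>f x\<bar> + D * \<bar>g x\<bar>" and "0 \<le> C" "0 \<le> D"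
  shows "h \<in> H0"
proof (rule H0I)
  show "h x = 0" if "x \<notin> ellinf" for x
    using le[of x] H0D(1)[OF f that] H0D(1)[OF g that] by simp
  fix n and xs :: "nat \<Rightarrow> 'a \<Rightarrow> real" assume *: "\<And>a. (\<Sum>k<(n::nat). \<bar>xs k a\<bar>) \<le> 1"
  have "(\<Sum>k<n. \<bar>h (xs k)\<bar>) \<le> (\<Sum>k<n. C * \<bar>f (xs k)\<bar> + D * \<bar>g (xs k)\<bar>)"
    by (intro sum_mono le)
  also have "\<dots> = C * (\<Sum>k<n. \<bar>f (xs k)\<bar>) + D * (\<Sum>k<n. \<bar>g (xs k)\<bar>)"
    by (simp add: sum.distrib sum_distrib_left)
  also have "\<dots> \<le> C * (fbl_norm f * 1) + D * (fbl_norm g * 1)"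
    using assms * by (intro add_mono mult_left_mono fbl_norm_bound) auto
  finally show "(\<Sum>k<n. \<bar>h (xs k)\<bar>) \<le> \<dots>" .
qed (rule assms(3))

section \<open>Linear and lattice operations on \<open>H0\<close>, and the evaluations
  \<open>delta x\<close>\<close>

lemma H0_add: "f \<in> H0 \<Longrightarrow> g \<in> H0 \<Longrightarrow> (\<lambda>x. f x + g x) \<in> H0"
  by (rule H0_dominated[of f g _ 1 1]) (auto simp: H0D(2) distrib_left)

lemma H0_diff: "f \<in> H0 \<Longrightarrow> g \<in> H0 \<Longrightarrow> (\<lambda>x. f x - g x) \<in> H0"
  by (rule H0_dominated[of f g _ 1 1]) (auto simp: H0D(2) right_diff_distrib)

lemma H0_scale: "f \<in> H0 \<Longrightarrow> (\<lambda>x. c * f x) \<in> H0"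
  by (rule H0_dominated[of f f _ "\<bar>c\<bar>" 0]) (auto simp: H0D(2) abs_mult)

lemma H0_max: "f \<in> H0 \<Longrightarrow> g \<in> H0 \<Longrightarrow> (\<lambda>x. max (f x) (g x)) \<in> H0"
  by (rule H0_dominated[of f g _ 1 1]) (auto simp: H0D(2) max_def)

lemma H0_min: "f \<in> H0 \<Longrightarrow> g \<in> H0 \<Longrightarrow> (\<lambda>x. min (f x) (g x)) \<in> H0"
  by (rule H0_dominated[of f g _ 1 1]) (auto simp: H0D(2) min_def)

lemma delta_H0:
  assumes x: "x \<in> ell1"
  shows "delta x \<in> H0"
proof (rule H0I)
  show "delta x (\<lambda>a. t * xs a) = t * delta x xs" if "xs \<in> ellinf" "0 < t" for xs t
    using that by (simp add: delta_def ellinf_scale pair_def mult.assoc infsum_cmult_right')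
  show "delta x xs = 0" if "xs \<notin> ellinf" for xs
    using that by (simp add: delta_def)
  fix n and xs :: "nat \<Rightarrow> 'a \<Rightarrow> real" assume *: "\<And>a. (\<Sum>k<(n::nat). \<bar>xs k a\<bar>) \<le> 1"
  have "xs k \<in> ellinf" if "k < n" for k
  proof (rule ellinfI)
    fix a show "\<bar>xs k a\<bar> \<le> 1"
      using *[of a] member_le_sum[of k "{..<n}" "\<lambda>k. \<bar>xs k a\<bar>"] that by simp
  qed
  then show "(\<Sum>k<n. \<bar>delta x (xs k)\<bar>) \<le> 1 * ell1_norm x"
    using pair_sum_le[of "{..<n}" xs x 1] x * by (simp add: delta_def)
qed

section \<open>Continuity of elements of \<open>FBL\<close>\<close>

definition cut :: "'a set \<Rightarrow> ('a \<Rightarrow> real) \<Rightarrow> 'a \<Rightarrow> real" where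
  "cut B x = (\<lambda>a. if a \<in> B then x a else 0)"

lemma cut_le: "\<bar>cut B x a\<bar> \<le> \<bar>x a\<bar>"
  by (simp add: cut_def)

lemma cut_ellinf: "x \<in> ellinf \<Longrightarrow> cut B x \<in> ellinf"
  by (elim ellinfE, rule ellinfI) (rule order_trans[OF cut_le])

text \<open>An instance of weak* continuity on bounded sets, which passes to norm limits because
  \<open>\<bar>f x\<bar> \<le> \<parallel>f\<parallel> \<parallel>x\<parallel>\<^sub>\<infinity>\<close>.\<close>
lemma FBL_cut_tendsto:
  assumes "f \<in> FBL" "x \<in> ellinf"
  shows "((\<lambda>B. f (cut B x)) \<longlongrightarrow> f x) (finite_subsets_at_top UNIV)"
proof -
  \<comment> \<open>\<open>S\<close> turns out to be one of the sets intersected in the definition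
    of \<open>FBL\<close>, so that \<open>FBL \<subseteq> S\<close>.\<close>
  define S :: "(('a \<Rightarrow> real) \<Rightarrow> real) set" where "S = {f \<in> H0. \<forall>x\<in>ellinf.
    ((\<lambda>B. f (cut B x)) \<longlongrightarrow> f x) (finite_subsets_at_top UNIV)}"
  have delta: "delta ` ell1 \<subseteq> S"
  proof clarify
    fix y :: "'a \<Rightarrow> real" assume y: "y \<in> ell1"
    have "((\<lambda>B. delta y (cut B x)) \<longlongrightarrow> delta y x) (finite_subsets_at_top UNIV)"
      if x: "x \<in> ellinf" for x
    proof -
      have "pair (cut B x) y = (\<Sum>a\<in>B. x a * y a)" if "finite B" for B
      proof -
        have "pair (cut B x) y = (\<Sum>\<^sub>\<infinity>a\<in>B. x a * y a)"
          unfolding pair_def by (rule infsum_cong_neutral) (auto simp: cut_def)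
        then show ?thesis using that by simp
      qed
      then have "\<forall>\<^sub>F B in finite_subsets_at_top UNIV. (\<Sum>a\<in>B. x a * y a) = delta y (cut B x)"
        using x by (intro eventually_finite_subsets_at_top_weakI) (simp add: delta_def cut_ellinf)
      moreover have "((\<lambda>B. \<Sum>a\<in>B. x a * y a) \<longlongrightarrow> delta y x) (finite_subsets_at_top UNIV)"
        using infsum_tendsto[OF summable_pair(2)[OF x y]] x by (simp add: delta_def pair_def)
      ultimately show ?thesis by (rule Lim_transform_eventually[rotated])
    qed
    then show "delta y \<in> S" using delta_H0[OF y] by (simp add: S_def)
  qed
  have closed: "f \<in> S" if g: "\<And>n. g n \<in> S" and f: "f \<in> H0"
    and lim: "(\<lambda>n. fbl_norm (\<lambda>xs. g n xs - f xs)) \<longlonglongrightarrow> 0" for g f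
  proof -
    have "((\<lambda>B. f (cut B x)) \<longlongrightarrow> f x) (finite_subsets_at_top UNIV)" if x: "x \<in> ellinf" for x
    \<comment> \<open>The limits in \<open>n\<close> and \<open>B\<close> are interchanged: all cuts
      of \<open>x\<close> share the bound \<open>T\<close>, so convergence in norm makes
      \<open>g n\<close> tend to \<open>f\<close> on them uniformly in \<open>B\<close>.\<close>
    proof (rule swap_uniform_limit')
      obtain T where T: "0 < T" "\<And>a. \<bar>x a\<bar> \<le> T" using x ellinfE by blast
      show "\<forall>\<^sub>F n in sequentially.
          ((\<lambda>B. g n (cut B x)) \<longlongrightarrow> g n x) (finite_subsets_at_top UNIV)"
        using g x by (simp add: S_def)
      have bound: "\<bar>g n y - f y\<bar> \<le> fbl_norm (\<lambda>xs. g n xs - f xs) * T"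
        if "\<And>a. \<bar>y a\<bar> \<le> T" for n y
        using fbl_norm_bound_single[OF H0_diff[OF _ f], of "g n" T y] g T(1) that
        by (simp add: S_def)
      have lim': "(\<lambda>n. fbl_norm (\<lambda>xs. g n xs - f xs) * T) \<longlonglongrightarrow> 0"
        using tendsto_mult_right[OF lim, of T] by simp
      have small: "\<forall>\<^sub>F n in sequentially. fbl_norm (\<lambda>xs. g n xs - f xs) * T < e" if "0 < e" for e
        using lim' that by (rule order_tendstoD)
      show "uniform_limit UNIV (\<lambda>n B. g n (cut B x)) (\<lambda>B. f (cut B x)) sequentially"
      proof (rule uniform_limitI)
        fix e :: real assume "0 < e"
        from small[OF this]
        show "\<forall>\<^sub>F n in sequentially. \<forall>B\<in>UNIV. dist (g n (cut B x)) (f (cut B x)) < e"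
        proof eventually_elim
          case (elim n)
          have "\<bar>g n (cut B x) - f (cut B x)\<bar> \<le> fbl_norm (\<lambda>xs. g n xs - f xs) * T" for B
            by (rule bound) (blast intro: order_trans cut_le T(2))
          then show ?case using elim by (auto simp: dist_real_def intro: le_less_trans)
        qed
      qed
      have "(\<lambda>n. g n x - f x) \<longlonglongrightarrow> 0"
        by (rule Lim_null_comparison[OF _ lim']) (use bound T(2) in simp)
      then show "(\<lambda>n. g n x) \<longlonglongrightarrow> f x" by (simp add: LIM_zero_iff)
    qed (auto simp: eventually_finite_subsets_at_top)
    then show ?thesis using f by (simp add: S_def)
  qed
  have "FBL \<subseteq> S"
    unfolding FBL_def
  proof (intro Inter_lower CollectI conjI delta)
    show "\<forall>g f. (\<forall>n. g n \<in> S) \<and> f \<in> H0 \<and>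
        (\<lambda>n. fbl_norm (\<lambda>xs. g n xs - f xs)) \<longlonglongrightarrow> 0 \<longrightarrow> f \<in> S"
      using closed by blast
  qed (auto simp: S_def H0_add H0_scale H0_max H0_min intro!: tendsto_intros)
  then show ?thesis using assms by (auto simp: S_def)
qed

text \<open>\<open>H0\<close> itself is among the sets being intersected.\<close>

lemma FBL_subset_H0: "FBL \<subseteq> H0"
  unfolding FBL_def
  by (rule Inter_lower) (auto simp: delta_H0 H0_add H0_scale H0_max H0_min)

section \<open>Weighted absolute values\<close>

text \<open>The value 0 off \<open>ellinf\<close> is the extensionality required by
  \<open>Hom\<close>.\<close>

definition wabs :: "('a \<Rightarrow> real) \<Rightarrow> ('a \<Rightarrow> real) \<Rightarrow> real" where
  "wabs d x = (if x \<in> ellinf then \<Sum>\<^sub>\<infinity>a. d a * \<bar>x a\<bar> else 0)"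

lemma summable_wabs:
  fixes d :: "'a \<Rightarrow> real"
  assumes "d summable_on UNIV" "\<And>a. 0 \<le> d a" "x \<in> ellinf"
  shows "(\<lambda>a. d a * \<bar>x a\<bar>) summable_on UNIV"
proof -
  obtain T where "\<And>a. \<bar>x a\<bar> \<le> T" using assms(3) ellinfE by blast
  then show ?thesis
    using summable_weighted(2)[of d "\<lambda>a. \<bar>x a\<bar>" T] assms by simp
qed

text \<open>After exchanging the sums, each coordinate \<open>a\<close> contributes at most
  \<open>d a\<close>, since the absolute values of an admissible family add up to at most 1
  there.\<close>

lemma wabs_H0:
  assumes d: "d summable_on UNIV" "\<And>a. 0 \<le> d a"
  shows "wabs d \<in> H0" "fbl_norm (wabs d) \<le> (\<Sum>\<^sub>\<infinity>a. d a)"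
proof -
  have nn: "0 \<le> wabs d x" for x
    unfolding wabs_def using d by (auto intro!: infsum_nonneg)
  have hom: "wabs d (\<lambda>a. t * x a) = t * wabs d x" if "x \<in> ellinf" "0 < t" for x t
    using that by (simp add: wabs_def ellinf_scale abs_mult mult.left_commute infsum_cmult_right')
  have out: "wabs d x = 0" if "x \<notin> ellinf" for x using that by (simp add: wabs_def)
  have "(\<Sum>k<n. \<bar>wabs d (xs k)\<bar>) \<le> (\<Sum>\<^sub>\<infinity>a. d a)"
    if *: "\<And>a. (\<Sum>k<(n::nat). \<bar>xs k a\<bar>) \<le> 1" for n xs
  proof -
    have xs: "xs k \<in> ellinf" if "k < n" for k
    proof (rule ellinfI)
      fix a show "\<bar>xs k a\<bar> \<le> 1"
        using *[of a] member_le_sum[of k "{..<n}" "\<lambda>k. \<bar>xs k a\<bar>"] that by simp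
    qed
    have "(\<Sum>k<n. \<bar>wabs d (xs k)\<bar>) = (\<Sum>k<n. \<Sum>\<^sub>\<infinity>a. d a * \<bar>xs k a\<bar>)"
      using xs unfolding abs_of_nonneg[OF nn] by (intro sum.cong) (simp_all add: wabs_def)
    also have "\<dots> = (\<Sum>\<^sub>\<infinity>a. \<Sum>k<n. d a * \<bar>xs k a\<bar>)"
      using summable_wabs[OF d xs] by (intro infsum_sum[symmetric]) auto
    also have "\<dots> \<le> (\<Sum>\<^sub>\<infinity>a. d a)"
    proof (rule infsum_mono)
      show "(\<lambda>a. \<Sum>k<n. d a * \<bar>xs k a\<bar>) summable_on UNIV"
        using summable_wabs[OF d xs] by (intro summable_on_sum) auto
      show "(\<Sum>k<n. d a * \<bar>xs k a\<bar>) \<le> d a" for a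
        using mult_left_mono[OF *[of a] d(2)[of a]] by (simp add: sum_distrib_left)
    qed (rule d)
    finally show ?thesis .
  qed
  from H0I[of "wabs d", OF hom out this]
  show "wabs d \<in> H0" "fbl_norm (wabs d) \<le> (\<Sum>\<^sub>\<infinity>a. d a)" by auto
qed

text \<open>The right-hand side uses only evaluations and operations under which \<open>FBL\<close>
  is closed; \<open>max\<close> with the negative is an absolute value.\<close>

lemma wabs_cut:
  assumes "finite B"
  shows "wabs (cut B d) x = (\<Sum>a\<in>B. d a * max (delta (unit_vec a) x) (- 1 * delta (unit_vec a) x))"
proof (cases "x \<in> ellinf")
  case True
  have "wabs (cut B d) x = (\<Sum>\<^sub>\<infinity>a\<in>B. d a * \<bar>x a\<bar>)"
    using True unfolding wabs_def by (simp, intro infsum_cong_neutral) (auto simp: cut_def)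
  also have "\<dots> = (\<Sum>a\<in>B. d a * \<bar>x a\<bar>)" using assms by simp
  finally show ?thesis using True by (simp add: delta_def pair_unit_vec abs_real_def max_def)
      (intro sum.cong; auto)
qed (simp add: wabs_def delta_def)

lemma wabs_FBL:
  assumes d: "d summable_on UNIV" "\<And>a. 0 \<le> d a"
  shows "wabs d \<in> FBL"
  unfolding FBL_def
proof (intro InterI, clarify)
  fix S :: "(('a \<Rightarrow> real) \<Rightarrow> real) set"
  assume delta: "delta ` ell1 \<subseteq> S"
    and add: "\<forall>f\<in>S. \<forall>g\<in>S. (\<lambda>xs. f xs + g xs) \<in> S"
    and scale: "\<forall>f\<in>S. \<forall>c::real. (\<lambda>xs. c * f xs) \<in> S"
    and max: "\<forall>f\<in>S. \<forall>g\<in>S. (\<lambda>xs. max (f xs) (g xs)) \<in> S"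
    and closed: "\<forall>g f. (\<forall>n. g n \<in> S) \<and> f \<in> H0 \<and>
             (\<lambda>n. fbl_norm (\<lambda>xs. g n xs - f xs)) \<longlonglongrightarrow> 0 \<longrightarrow> f \<in> S"
  have delta_unit: "delta (unit_vec a) \<in> S" for a
    using delta unit_vec_ball[of a] by (auto simp: ell1_ball_def)
  have finite: "wabs (cut B d) \<in> S" if "finite B" for B
  proof -
    have "(\<lambda>x. \<Sum>a\<in>B. d a * max (delta (unit_vec a) x) (- 1 * delta (unit_vec a) x)) \<in> S"
      using that
    proof induction
      case empty
      \<comment> \<open>The zero function is 0 times an arbitrary evaluation.\<close>
      then show ?case using scale[rule_format, OF delta_unit, of 0 undefined] by simp
    next
      case (insert a B)
      have "(\<lambda>x. d a * max (delta (unit_vec a) x) (- 1 * delta (unit_vec a) x)) \<in> S"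
        by (rule scale[rule_format], rule max[rule_format])
          (rule delta_unit, rule scale[rule_format], rule delta_unit)
      from add[rule_format, OF this insert.IH] show ?case
        using insert.hyps by simp
    qed
    moreover have "wabs (cut B d)
        = (\<lambda>x. \<Sum>a\<in>B. d a * max (delta (unit_vec a) x) (- 1 * delta (unit_vec a) x))"
      using wabs_cut[OF that] by blast
    ultimately show ?thesis by simp
  qed
  have "\<exists>B. finite B \<and> fbl_norm (\<lambda>x. wabs (cut B d) x - wabs d x) \<le> e" if e: "0 < e" for e
  proof -
    obtain B where B: "finite B" "dist (sum d B) (infsum d UNIV) \<le> e"
      using infsum_finite_approximation[OF d(1) e] by blast
    have cut: "cut B' d summable_on UNIV" for B'
      by (rule summable_on_comparison_test[OF d(1)]) (use d(2) in \<open>auto simp: cut_def\<close>)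
    have pos: "0 \<le> cut B' d a" for B' a
      using d(2) by (simp add: cut_def)
    have split: "d a = cut B d a + cut (- B) d a" for a by (simp add: cut_def)
    have "wabs d x = wabs (cut B d) x + wabs (cut (- B) d) x" for x
      unfolding wabs_def
      using infsum_add[OF summable_wabs[OF cut pos, of x B] summable_wabs[OF cut pos, of x "- B"]]
      by (simp add: split[symmetric] flip: distrib_right)
    \<comment> \<open>The error is the tail \<open>wabs (cut (- B) d)\<close> up to sign, and its
      norm is at most the mass of \<open>d\<close> off \<open>B\<close>.\<close>
    then have "\<bar>wabs (cut B d) x - wabs d x\<bar> = \<bar>wabs (cut (- B) d) x\<bar>" for x by simp
    then have "fbl_norm (\<lambda>x. wabs (cut B d) x - wabs d x) = fbl_norm (wabs (cut (- B) d))"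
      unfolding fbl_norm_def fbl_sums_def by simp
    also have "\<dots> \<le> infsum (cut (- B) d) UNIV"
      by (rule wabs_H0[OF cut pos])
    also have "\<dots> = infsum d UNIV - sum d B"
    proof -
      have "infsum d UNIV = infsum (cut B d) UNIV + infsum (cut (- B) d) UNIV"
        using infsum_add[OF cut[of B] cut[of "- B"]] by (simp add: split[symmetric])
      moreover have "infsum (cut B d) UNIV = infsum d B"
        by (rule infsum_cong_neutral) (auto simp: cut_def)
      ultimately show ?thesis using B(1) by simp
    qed
    also have "\<dots> \<le> e" using B(2) by (simp add: dist_real_def)
    finally show ?thesis using B(1) by blast
  qed
  \<comment> \<open>The closure condition in \<open>FBL\<close> speaks of sequences, so the net of
    finite sets is replaced by one finite set for each accuracy \<open>1 / Suc n\<close>.\<close>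
  then have "\<forall>n. \<exists>B. finite B \<and> fbl_norm (\<lambda>x. wabs (cut B d) x - wabs d x) \<le> 1 / real (Suc n)"
    by simp
  then obtain B where B: "\<And>n. finite (B n)"
    "\<And>n. fbl_norm (\<lambda>x. wabs (cut (B n) d) x - wabs d x) \<le> 1 / real (Suc n)"
    by metis
  have H0: "(\<lambda>x. wabs (cut (B n) d) x - wabs d x) \<in> H0" for n
  proof (intro H0_diff wabs_H0 d)
    show "cut (B n) d summable_on UNIV"
      by (rule summable_on_comparison_test[OF d(1)]) (use d(2) in \<open>auto simp: cut_def\<close>)
  qed (use d(2) in \<open>simp add: cut_def\<close>)
  have "(\<lambda>n. fbl_norm (\<lambda>x. wabs (cut (B n) d) x - wabs d x)) \<longlonglongrightarrow> 0"
  proof (rule tendsto_sandwich[OF _ _ tendsto_const])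
    show "(\<lambda>n. 1 / real (Suc n)) \<longlonglongrightarrow> 0" by (rule LIMSEQ_Suc[OF lim_1_over_n])
  qed (use B(2) fbl_norm_nonneg[OF H0] in auto)
  then show "wabs d \<in> S"
    using closed[rule_format, of "\<lambda>n. wabs (cut (B n) d)" "wabs d"] finite[OF B(1)] wabs_H0(1)[OF d]
    by simp
qed

section \<open>Domination of a directed family\<close>

text \<open>The factor 0 is included because multipliers may vanish.\<close>

lemma H0_hom:
  assumes "f \<in> H0" "0 \<le> t"
  shows "f (\<lambda>a. t * x a) = t * f x"
  using assms H0D(2) H0_zero by (cases "t = 0") auto

lemma fle_H0:
  assumes "f \<in> H0" "g \<in> H0" "fle f g"
  shows "f x \<le> g x"
  using assms H0D(1)[OF assms(1), of x] H0D(1)[OF assms(2), of x]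
  unfolding fle_def by (cases "x \<in> ellinf") auto

lemma fbl_norm_mono:
  assumes f: "f \<in> H0" and g: "g \<in> H0" and le: "\<And>x. \<bar>f x\<bar> \<le> \<bar>g x\<bar>"
  shows "fbl_norm f \<le> fbl_norm g"
proof (rule H0I(2))
  fix n and xs :: "nat \<Rightarrow> 'a \<Rightarrow> real" assume *: "\<And>a. (\<Sum>k<(n::nat). \<bar>xs k a\<bar>) \<le> 1"
  have "(\<Sum>k<n. \<bar>f (xs k)\<bar>) \<le> (\<Sum>k<n. \<bar>g (xs k)\<bar>)"
    by (intro sum_mono le)
  also have "\<dots> \<le> fbl_norm g * 1"
    using * by (intro fbl_norm_bound g) auto
  finally show "(\<Sum>k<n. \<bar>f (xs k)\<bar>) \<le> fbl_norm g" by simp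
qed (use H0D(1,2)[OF f] in auto)

lemma directed_upper_bound:
  assumes "finite G" "G \<subseteq> F" "F \<noteq> {}" "F \<subseteq> H0"
    and directed: "\<forall>f\<in>F. \<forall>g\<in>F. \<exists>h\<in>F. fle f h \<and> fle g h"
  shows "\<exists>h\<in>F. \<forall>f\<in>G. fle f h"
  using assms(1,2)
proof induction
  case empty
  then show ?case using \<open>F \<noteq> {}\<close> by blast
next
  case (insert g G)
  then obtain h where h: "h \<in> F" "\<forall>f\<in>G. fle f h" by blast
  obtain h' where "h' \<in> F" "fle g h'" "fle h h'"
    using directed h(1) insert.prems by blast
  then show ?case using h(2) unfolding fle_def by (fastforce intro: order_trans)
qed

lemma dominating_weights:
  assumes F: "F \<subseteq> H0" "F \<noteq> {}"
    and directed: "\<forall>f\<in>F. \<forall>g\<in>F. \<exists>h\<in>F. fle f h \<and> fle g h"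
    and M: "\<And>f. f \<in> F \<Longrightarrow> fbl_norm f \<le> M"
  shows "\<exists>c\<in>weights M. \<forall>f\<in>F. \<forall>x. finite {a. x a \<noteq> 0} \<longrightarrow>
    f x \<le> (\<Sum>a | x a \<noteq> 0. c a * \<bar>x a\<bar>)"
proof -
  \<comment> \<open>Each pair in \<open>J\<close> is one constraint on \<open>c\<close>. Finite
    support of the point makes it depend on finitely many coordinates, so \<open>D j\<close> is
    closed and the finite intersection property applies.\<close>
  define J where "J = {j :: _ \<times> ('a \<Rightarrow> real). fst j \<in> F \<and> finite {a. snd j a \<noteq> 0}}"
  define D where "D j = {c. fst j (snd j) \<le> (\<Sum>a | snd j a \<noteq> 0. c a * \<bar>snd j a\<bar>)}"
    for j :: "(('a \<Rightarrow> real) \<Rightarrow> real) \<times> ('a \<Rightarrow> real)"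
  have "0 \<le> M"
    using F M fbl_norm_nonneg by (meson ex_in_conv order_trans subsetD)
  have "weights M \<inter> (\<Inter>j\<in>J. D j) \<noteq> {}"
  proof (rule compact_imp_fip_image[OF compact_weights])
    show "closed (D j)" for j
      unfolding D_def
      by (intro closed_Collect_le continuous_on_sum continuous_on_mult continuous_on_const) auto
    fix J' assume J': "finite J'" "J' \<subseteq> J"
    have "\<exists>c\<in>weights M. \<forall>j\<in>J'. fst j (snd j) \<le> (\<Sum>a | \<bar>snd j a\<bar> \<noteq> 0. c a * \<bar>snd j a\<bar>)"
    proof (rule finite_domination[OF J'(1) \<open>0 \<le> M\<close>])
      show "finite {a. \<bar>snd j a\<bar> \<noteq> 0}" if "j \<in> J'" for j
        using that J' by (auto simp: J_def)
      fix l :: "_ \<Rightarrow> real" and T :: real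
      assume l: "\<And>j. j \<in> J' \<Longrightarrow> 0 \<le> l j" and T: "0 < T" "\<And>a. (\<Sum>j\<in>J'. l j * \<bar>snd j a\<bar>) \<le> T"
      \<comment> \<open>Replacing all functions by one \<open>h\<close> above them turns the
        combination into a norm sum of \<open>h\<close> at the points \<open>l j * snd j\<close>,
        whose absolute values add up to at most \<open>T\<close> in every coordinate.\<close>
      obtain h where h: "h \<in> F" "\<forall>f\<in>fst ` J'. fle f h"
        using directed_upper_bound[of "fst ` J'" F] J' F directed by (auto simp: J_def)
      then have hH: "h \<in> H0" using F by blast
      have "(\<Sum>j\<in>J'. l j * fst j (snd j)) \<le> (\<Sum>j\<in>J'. \<bar>h (\<lambda>a. l j * snd j a)\<bar>)"
      proof (rule sum_mono)
        fix j assume j: "j \<in> J'"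
        then have "fst j (snd j) \<le> h (snd j)"
          using J' F h hH by (intro fle_H0[where f = "fst j" and g = h]) (auto simp: J_def)
        then have "l j * fst j (snd j) \<le> l j * h (snd j)"
          using l[OF j] by (rule mult_left_mono)
        also have "\<dots> = h (\<lambda>a. l j * snd j a)"
          using H0_hom[OF hH l[OF j]] by simp
        finally show "l j * fst j (snd j) \<le> \<bar>h (\<lambda>a. l j * snd j a)\<bar>" by simp
      qed
      also have "\<dots> \<le> fbl_norm h * T"
        using T l by (intro fbl_norm_bound hH J') (simp_all add: abs_mult)
      also have "\<dots> \<le> M * T"
        using M[OF h(1)] T(1) by (simp add: mult_right_mono)
      finally show "(\<Sum>j\<in>J'. l j * fst j (snd j)) \<le> M * T" .
    qed simp
    then show "weights M \<inter> (\<Inter>j\<in>J'. D j) \<noteq> {}" by (auto simp: D_def)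
  qed
  then obtain c where c: "c \<in> weights M" "\<And>j. j \<in> J \<Longrightarrow> c \<in> D j" by blast
  have "f x \<le> (\<Sum>a | x a \<noteq> 0. c a * \<bar>x a\<bar>)" if "f \<in> F" "finite {a. x a \<noteq> 0}" for f x
    using c(2)[of "(f, x)"] that by (simp add: J_def D_def)
  with c(1) show ?thesis by blast
qed

theorem theorem4p11:
  fixes F :: "(('a \<Rightarrow> real) \<Rightarrow> real) set"
  assumes "F \<subseteq> FBL"
    and "\<forall>f\<in>F. fle (\<lambda>_. 0) f"
    and "F \<noteq> {}"
    and "\<forall>f\<in>F. \<forall>g\<in>F. \<exists>h\<in>F. fle f h \<and> fle g h"
    and "bdd_above (fbl_norm ` F)"
  shows "\<exists>y0\<in>FBL. (\<forall>f\<in>F. fle f y0) \<and> fbl_norm y0 = Sup (fbl_norm ` F)"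
proof -
  define M where "M = Sup (fbl_norm ` F)"
  have FH: "F \<subseteq> H0" using assms(1) FBL_subset_H0 by blast
  have M: "fbl_norm f \<le> M" if "f \<in> F" for f
    unfolding M_def using that assms(5) by (intro cSup_upper) auto
  obtain c where c: "c \<in> weights M"
    and dom: "\<And>f x. f \<in> F \<Longrightarrow> finite {a. x a \<noteq> 0} \<Longrightarrow> f x \<le> (\<Sum>a | x a \<noteq> 0. c a * \<bar>x a\<bar>)"
    using dominating_weights[OF FH assms(3,4) M] by blast
  have c0: "0 \<le> c a" and cM: "finite B \<Longrightarrow> sum c B \<le> M" for a B
    using c by (auto simp: weights_def)
  have cs: "c summable_on UNIV"
    using c0 cM by (intro nonneg_bdd_above_summable_on) (auto intro!: bdd_aboveI[of _ M])
  \<comment> \<open>At a cut of \<open>x\<close> the finite sum from \<open>dom\<close> is at most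
    the full series; continuity along the cuts carries the inequality to \<open>x\<close>.\<close>
  have le: "f x \<le> wabs c x" if f: "f \<in> F" and x: "x \<in> ellinf" for f x
  proof (rule tendsto_upperbound)
    show "((\<lambda>B. f (cut B x)) \<longlongrightarrow> f x) (finite_subsets_at_top UNIV)"
      using FBL_cut_tendsto assms(1) f x by blast
    have "f (cut B x) \<le> wabs c x" if B: "finite B" for B
    proof -
      have fin: "finite {a. cut B x a \<noteq> 0}"
        using B by (rule rev_finite_subset) (auto simp: cut_def)
      then have "f (cut B x) \<le> (\<Sum>a | cut B x a \<noteq> 0. c a * \<bar>cut B x a\<bar>)"
        by (rule dom[OF f])
      also have "\<dots> \<le> (\<Sum>a | cut B x a \<noteq> 0. c a * \<bar>x a\<bar>)"
        by (intro sum_mono mult_left_mono cut_le c0)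
      also have "\<dots> \<le> (\<Sum>\<^sub>\<infinity>a. c a * \<bar>x a\<bar>)"
        using c0 by (intro finite_sum_le_infsum summable_wabs cs x fin) auto
      finally show ?thesis using x by (simp add: wabs_def)
    qed
    then show "\<forall>\<^sub>F B in finite_subsets_at_top UNIV. f (cut B x) \<le> wabs c x"
      by (intro eventually_finite_subsets_at_top_weakI) simp
  qed simp
  have "fbl_norm (wabs c) \<le> M"
    using wabs_H0(2)[OF cs c0] infsum_le_finite_sums[OF cs cM] by (rule order_trans)
  \<comment> \<open>Positivity of the members of \<open>F\<close> turns
    \<open>f \<le> wabs c\<close> into a comparison of absolute values, under which the norm is
    monotone.\<close>
  moreover have "M \<le> fbl_norm (wabs c)"
    unfolding M_def
  proof (rule cSup_least)
    fix s assume "s \<in> fbl_norm ` F"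
    then obtain f where f: "f \<in> F" "s = fbl_norm f" by blast
    have fH: "f \<in> H0" using f(1) FH by blast
    have "\<bar>f x\<bar> \<le> \<bar>wabs c x\<bar>" for x
    proof (cases "x \<in> ellinf")
      case True
      then show ?thesis using le[OF f(1)] assms(2) f(1) by (fastforce simp: fle_def)
    qed (simp add: H0D(1)[OF fH])
    then show "s \<le> fbl_norm (wabs c)"
      unfolding f(2) by (intro fbl_norm_mono fH wabs_H0(1)[OF cs c0])
  qed (use assms(3) in simp)
  ultimately have "fbl_norm (wabs c) = Sup (fbl_norm ` F)" by (simp add: M_def)
  then show ?thesis
    using wabs_FBL[OF cs c0] le unfolding fle_def by blast
qed

end
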